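(* In the setting described in the context, let $\bar G_{11}=W_{G,2}^\top GW_{G,2}$, $\bar G_{21}=W_{G,1}^\top GW_{G,2}$, $\bar R_{11}=T_{R,2}RT_{R,2}^\top$ and $\bar R_{12}=T_{R,2}RT_{R,1}^\top$. Then $$G=W_{G,2}\bar G_{11}W_{G,2}^\top+W_{G,1}\bar G_{21}W_{G,2}^\top+W_{G,1}\Lambda_{G,1}W_{G,1}^\top$$ and $$R=T_{R,2}^\top\bar R_{11}T_{R,2}+T_{R,2}^\top\bar R_{12}T_{R,1}+T_{R,1}^\top\Lambda_{R,1}T_{R,1}.$$
   Context: Setting. Let $A_0,A_1,A_2\in\mathbb{R}^{m\times m}$, $A(z)=A_0+zA_1+z^2A_2$, with $a(z)=\det A(z)$ not identically zero. The eigenvalues of $A(z)$ are the $2m$ roots $\lambda_1,\dots,\lambda_{2m}$ of $a(z)$ counted with multiplicity ($s$ roots at infinity are added if $\deg a=2m-s$), ordered so that $|\lambda_1|\le\cdots\le|\lambda_{2m}|$. Let $1\le\ell<m$ and assume that $a(z)$ has $\ell$ distinct roots $\mu_1,\dots,\mu_\ell$ of modulus $1$, each of multiplicity $2$, and $|\lambda_{m-\ell}|<1=|\mu_1|=\cdots=|\mu_\ell|<|\lambda_{m+\ell+1}|$. Assume there exist unique solutions $G,R\in\mathbb{R}^{m\times m}$ of $A_0+A_1X+A_2X^2=0$ and $X^2A_0+XA_1+A_2=0$, respectively, such that $G$ has eigenvalues $\lambda_1,\dots,\lambda_{m-\ell},\mu_1,\dots,\mu_\ell$ and $R$ has eigenvalues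 $1/\lambda_{m+\ell+1},\dots,1/\lambda_{2m},1/\mu_1,\dots,1/\mu_\ell$ (with $1/\infty=0$). Let $W_{G,1}\in\mathbb{R}^{m\times(m-\ell)}$ and $\Lambda_{G,1}\in\mathbb{R}^{(m-\ell)\times(m-\ell)}$ satisfy $GW_{G,1}=W_{G,1}\Lambda_{G,1}$, $W_{G,1}^\top W_{G,1}=I_{m-\ell}$, and $\Lambda_{G,1}$ has eigenvalues $\lambda_1,\dots,\lambda_{m-\ell}$. Let $T_{R,1}\in\mathbb{R}^{(m-\ell)\times m}$ and $\Lambda_{R,1}\in\mathbb{R}^{(m-\ell)\times(m-\ell)}$ satisfy $T_{R,1}R=\Lambda_{R,1}T_{R,1}$, $T_{R,1}T_{R,1}^\top=I_{m-\ell}$, and $\Lambda_{R,1}$ has eigenvalues $1/\lambda_{m+\ell+1},\dots,1/\lambda_{2m}$. Let $W_{G,2}\in\mathbb{R}^{m\times\ell}$ and $T_{R,2}\in\mathbb{R}^{\ell\times m}$ be such that $W_G=[\,W_{G,2}\ \ W_{G,1}\,]$ and $T_R=\begin{bmatrix} T_{R,2} \\ T_{R,1} \end{bmatrix}$ are orthogonal $m\times m$ matrices. *)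

theory Defs
  imports "Jordan_Normal_Form.Char_Poly" "HOL-Library.Extended_Real"
begin

definition quadratic_pencil :: "real mat \<Rightarrow> real mat \<Rightarrow> real mat \<Rightarrow> real poly mat" where
  "quadratic_pencil A0 A1 A2 =
     map_mat (\<lambda>c. [:c:]) A0 + [:0, 1:] \<cdot>\<^sub>m map_mat (\<lambda>c. [:c:]) A1
       + [:0, 1:] ^ 2 \<cdot>\<^sub>m map_mat (\<lambda>c. [:c:]) A2"

text \<open>The determinant of the pencil is real; it is coerced to a complex polynomial because its
  roots are taken in the complex plane.\<close>
definition pencil_det :: "real mat \<Rightarrow> real mat \<Rightarrow> real mat \<Rightarrow> complex poly" where
  "pencil_det A0 A1 A2 = map_poly complex_of_real (det (quadratic_pencil A0 A1 A2))"

datatype ext_complex = Fin complex | Infty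

fun ext_cmod :: "ext_complex \<Rightarrow> ereal" where
  "ext_cmod (Fin z) = ereal (cmod z)"
| "ext_cmod Infty = \<infinity>"

text \<open>Only meaningful away from \<open>Fin 0\<close>, where it takes the junk value \<open>0\<close>.\<close>
fun ext_recip :: "ext_complex \<Rightarrow> complex" where
  "ext_recip (Fin z) = 1 / z"
| "ext_recip Infty = 0"

text \<open>A root at infinity is added for every degree by which the determinant falls short of
  \<open>2 m\<close>, where \<open>m\<close> is the size of the coefficients.\<close>
definition pencil_eigenvalues :: "real mat \<Rightarrow> real mat \<Rightarrow> real mat \<Rightarrow> ext_complex multiset" where
  "pencil_eigenvalues A0 A1 A2 =
     image_mset Fin (proots (pencil_det A0 A1 A2))
       + replicate_mset (2 * dim_row A0 - degree (pencil_det A0 A1 A2)) Infty"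

definition mat_eigenvalues :: "real mat \<Rightarrow> complex multiset" where
  "mat_eigenvalues M = proots (char_poly (map_mat complex_of_real M))"

definition append_cols :: "'a :: zero mat \<Rightarrow> 'a mat \<Rightarrow> 'a mat" (infixr \<open>@\<^sub>c\<close> 65) where
  "A @\<^sub>c B = four_block_mat A B (0\<^sub>m 0 (dim_col A)) (0\<^sub>m 0 (dim_col B))"

text \<open>The library's \<^const>\<open>orthogonal_mat\<close> only asks for pairwise orthogonal nonzero columns, not
  for columns of norm one.\<close>
definition real_orthogonal_mat :: "nat \<Rightarrow> real mat \<Rightarrow> bool" where
  "real_orthogonal_mat n Q \<longleftrightarrow>
     Q \<in> carrier_mat n n \<and> Q\<^sup>T * Q = 1\<^sub>m n \<and> Q * Q\<^sup>T = 1\<^sub>m n"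

end

theory Submission
  imports Defs
begin

text \<open>Orthogonality of \<open>[V W]\<close> says \<open>V V\<^sup>T + W W\<^sup>T = 1\<close>. Inserting this resolution of the identity
  on the right of \<open>A\<close>, and on the left of the summand \<open>A V V\<^sup>T\<close> only, gives three terms once
  \<open>A W W\<^sup>T\<close> is rewritten as \<open>W L W\<^sup>T\<close>. The formula for \<open>R\<close> is that of \<open>G\<close> for the transpose.\<close>

text \<open>\<open>append_cols\<close> is a four-block matrix whose lower blocks have no rows, so
  block multiplication leaves only the top left block. This turns orthogonality of
  \<open>[V W]\<close> into the resolution of the identity.\<close>

lemma append_cols_mult_transpose:
  fixes A B :: "'a :: comm_semiring_0 mat"
  assumes A: "A \<in> carrier_mat n k" and B: "B \<in> carrier_mat n r"
  shows "(A @\<^sub>c B) * (A @\<^sub>c B)\<^sup>T = A * A\<^sup>T + B * B\<^sup>T"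
proof -
  have T: "(A @\<^sub>c B)\<^sup>T = four_block_mat A\<^sup>T (0\<^sub>m k 0) B\<^sup>T (0\<^sub>m r 0)"
    using A B transpose_four_block_mat[OF A B zero_carrier_mat zero_carrier_mat]
    by (simp add: append_cols_def zero_transpose_mat)
  have AB: "A @\<^sub>c B = four_block_mat A B (0\<^sub>m 0 k) (0\<^sub>m 0 r)"
    using A B by (simp add: append_cols_def)
  have "(A @\<^sub>c B) * (A @\<^sub>c B)\<^sup>T = four_block_mat
      (A * A\<^sup>T + B * B\<^sup>T) (A * 0\<^sub>m k 0 + B * 0\<^sub>m r 0)
      (0\<^sub>m 0 k * A\<^sup>T + 0\<^sub>m 0 r * B\<^sup>T) (0\<^sub>m 0 k * 0\<^sub>m k 0 + 0\<^sub>m 0 r * 0\<^sub>m r 0)"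
    \<comment> \<open>The order matters: \<open>AB\<close> would also rewrite inside the transpose,
      and \<open>T\<close> would then no longer match.\<close>
    unfolding T unfolding AB
    by (rule mult_four_block_mat[where ?nr1.0 = n and ?n1.0 = k and ?n2.0 = r and ?nr2.0 = 0
          and ?nc1.0 = n and ?nc2.0 = 0]) (use A B in auto)
  \<comment> \<open>The other three blocks have zero rows or zero columns and contribute no
    entries.\<close>
  also have "\<dots> = A * A\<^sup>T + B * B\<^sup>T"
    using A B by (intro eq_matI) auto
  finally show ?thesis .
qed

lemma append_rows_transpose:
  fixes A B :: "'a :: zero mat"
  assumes A: "A \<in> carrier_mat k n" and B: "B \<in> carrier_mat r n"
  shows "(A @\<^sub>r B)\<^sup>T = A\<^sup>T @\<^sub>c B\<^sup>T"
  using A B transpose_four_block_mat[OF A zero_carrier_mat B zero_carrier_mat]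
  by (simp add: append_rows_def append_cols_def zero_transpose_mat)

lemma transpose_mult3:
  fixes A B C :: "'a :: comm_semiring_0 mat"
  assumes A: "A \<in> carrier_mat n p" and B: "B \<in> carrier_mat p q" and C: "C \<in> carrier_mat q r"
  shows "(A * B * C)\<^sup>T = C\<^sup>T * B\<^sup>T * A\<^sup>T"
proof -
  have "(A * B * C)\<^sup>T = C\<^sup>T * (B\<^sup>T * A\<^sup>T)"
    by (simp only: transpose_mult[OF mult_carrier_mat[OF A B] C] transpose_mult[OF A B])
  also have "\<dots> = C\<^sup>T * B\<^sup>T * A\<^sup>T"
    by (rule assoc_mult_mat[symmetric]) (use A B C in auto)
  finally show ?thesis .
qed

text \<open>For orthogonal \<open>[V W]\<close> this is the block triangular form of
  \<open>A\<close> in that basis: the columns of \<open>W\<close> span an invariant subspace, so the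
  block \<open>V\<^sup>T * A * W\<close> vanishes and \<open>W\<^sup>T * A * W\<close> is
  \<open>L\<close>.\<close>

lemma invariant_subspace_decomposition:
  fixes A L V W :: "'a :: comm_semiring_1 mat"
  assumes A: "A \<in> carrier_mat n n" and V: "V \<in> carrier_mat n k" and W: "W \<in> carrier_mat n r"
    and inv: "A * W = W * L"
    and res: "V * V\<^sup>T + W * W\<^sup>T = 1\<^sub>m n"
  shows "A = V * (V\<^sup>T * A * V) * V\<^sup>T + W * (W\<^sup>T * A * V) * V\<^sup>T + W * L * W\<^sup>T"
proof -
  define P where "P = V * V\<^sup>T"
  define Q where "Q = W * W\<^sup>T"
  have P: "P \<in> carrier_mat n n" and Q: "Q \<in> carrier_mat n n"
    using V W by (simp_all add: P_def Q_def)
  have PQ: "P + Q = 1\<^sub>m n"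
    using res by (simp add: P_def Q_def)
  have AP: "A * P \<in> carrier_mat n n"
    using A P by simp
  \<comment> \<open>Both sides are reassociated to \<open>U * (S * (A * (V * V\<^sup>T)))\<close>.
    Taking \<open>U * S\<close> to be \<open>P\<close> or \<open>Q\<close> covers both parts of
    \<open>A * P\<close>.\<close>
  have regroup: "(U * S) * (A * (V * V\<^sup>T)) = U * (S * A * V) * V\<^sup>T"
    if U: "U \<in> carrier_mat n j" and S: "S \<in> carrier_mat j n" for U S j
  proof -
    have T: "V\<^sup>T \<in> carrier_mat k n"
      using V by simp
    note prods = mult_carrier_mat[OF S A] mult_carrier_mat[OF V T]
    show ?thesis
      by (simp only: assoc_mult_mat[OF U S mult_carrier_mat[OF A prods(2)]]
          assoc_mult_mat[OF U mult_carrier_mat[OF prods(1) V] T]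
          assoc_mult_mat[OF prods(1) V T] assoc_mult_mat[OF S A prods(2)])
  qed
  have "A = A * P + A * Q"
    using A by (simp add: PQ flip: mult_add_distrib_mat[OF A P Q])
  also have "A * P = P * (A * P) + Q * (A * P)"
    by (simp only: PQ left_mult_one_mat[OF AP] flip: add_mult_distrib_mat[OF P Q AP])
  also have "P * (A * P) = V * (V\<^sup>T * A * V) * V\<^sup>T"
    unfolding P_def using V by (intro regroup) auto
  also have "Q * (A * P) = W * (W\<^sup>T * A * V) * V\<^sup>T"
    unfolding P_def Q_def using W by (intro regroup) auto
  also have "A * Q = W * L * W\<^sup>T"
    using A W by (simp add: Q_def flip: inv)
  finally show ?thesis .
qed

theorem proposition3:
  fixes m l :: nat
    and A0 A1 A2 G R :: "real mat"
    and lam :: "nat \<Rightarrow> ext_complex" and mu :: "nat \<Rightarrow> complex"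
    and WG1 WG2 LG1 TR1 TR2 LR1 G11 G21 R11 R12 :: "real mat"
  assumes l: "1 \<le> l" "l < m"
    and A: "A0 \<in> carrier_mat m m" "A1 \<in> carrier_mat m m" "A2 \<in> carrier_mat m m"
    and det_nonzero: "pencil_det A0 A1 A2 \<noteq> 0"
    and lam_eigenvalues: "pencil_eigenvalues A0 A1 A2 = image_mset lam (mset_set {1..2 * m})"
    and lam_ordered: "\<And>i j. 1 \<le> i \<Longrightarrow> i \<le> j \<Longrightarrow> j \<le> 2 * m \<Longrightarrow> ext_cmod (lam i) \<le> ext_cmod (lam j)"
    and mu_distinct: "inj_on mu {1..l}"
    and mu_double: "\<And>i. i \<in> {1..l} \<Longrightarrow> order (mu i) (pencil_det A0 A1 A2) = 2"
    and mu_unit: "\<And>i. i \<in> {1..l} \<Longrightarrow> cmod (mu i) = 1"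
    and splitting: "ext_cmod (lam (m - l)) < 1" "1 < ext_cmod (lam (m + l + 1))"
    and G: "G \<in> carrier_mat m m"
      "A0 + A1 * G + A2 * G ^\<^sub>m 2 = 0\<^sub>m m m"
      "image_mset Fin (mat_eigenvalues G) =
         image_mset lam (mset_set {1..m - l}) + image_mset (\<lambda>i. Fin (mu i)) (mset_set {1..l})"
    and G_unique: "\<And>X. X \<in> carrier_mat m m \<Longrightarrow>
      A0 + A1 * X + A2 * X ^\<^sub>m 2 = 0\<^sub>m m m \<Longrightarrow>
      image_mset Fin (mat_eigenvalues X) =
        image_mset lam (mset_set {1..m - l}) + image_mset (\<lambda>i. Fin (mu i)) (mset_set {1..l}) \<Longrightarrow>
      X = G"
    and R: "R \<in> carrier_mat m m"
      "R ^\<^sub>m 2 * A0 + R * A1 + A2 = 0\<^sub>m m m"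
      "mat_eigenvalues R =
         image_mset (\<lambda>i. ext_recip (lam i)) (mset_set {m + l + 1..2 * m})
           + image_mset (\<lambda>i. 1 / mu i) (mset_set {1..l})"
    and R_unique: "\<And>X. X \<in> carrier_mat m m \<Longrightarrow>
      X ^\<^sub>m 2 * A0 + X * A1 + A2 = 0\<^sub>m m m \<Longrightarrow>
      mat_eigenvalues X =
        image_mset (\<lambda>i. ext_recip (lam i)) (mset_set {m + l + 1..2 * m})
          + image_mset (\<lambda>i. 1 / mu i) (mset_set {1..l}) \<Longrightarrow>
      X = R"
    and WG1: "WG1 \<in> carrier_mat m (m - l)" "LG1 \<in> carrier_mat (m - l) (m - l)"
      "G * WG1 = WG1 * LG1" "WG1\<^sup>T * WG1 = 1\<^sub>m (m - l)"
      "image_mset Fin (mat_eigenvalues LG1) = image_mset lam (mset_set {1..m - l})"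
    and TR1: "TR1 \<in> carrier_mat (m - l) m" "LR1 \<in> carrier_mat (m - l) (m - l)"
      "TR1 * R = LR1 * TR1" "TR1 * TR1\<^sup>T = 1\<^sub>m (m - l)"
      "mat_eigenvalues LR1 = image_mset (\<lambda>i. ext_recip (lam i)) (mset_set {m + l + 1..2 * m})"
    and WG2: "WG2 \<in> carrier_mat m l" "real_orthogonal_mat m (WG2 @\<^sub>c WG1)"
    and TR2: "TR2 \<in> carrier_mat l m" "real_orthogonal_mat m (TR2 @\<^sub>r TR1)"
    and G11: "G11 = WG2\<^sup>T * G * WG2"
    and G21: "G21 = WG1\<^sup>T * G * WG2"
    and R11: "R11 = TR2 * R * TR2\<^sup>T"
    and R12: "R12 = TR2 * R * TR1\<^sup>T"
  shows "G = WG2 * G11 * WG2\<^sup>T + WG1 * G21 * WG2\<^sup>T + WG1 * LG1 * WG1\<^sup>T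
       \<and> R = TR2\<^sup>T * R11 * TR2 + TR2\<^sup>T * R12 * TR1 + TR1\<^sup>T * LR1 * TR1"
proof
  \<comment> \<open>This is \<open>Q * Q\<^sup>T = 1\<^sub>m m\<close> for
    \<open>Q = WG2 @\<^sub>c WG1\<close>, expanded by blocks.\<close>
  have "WG2 * WG2\<^sup>T + WG1 * WG1\<^sup>T = 1\<^sub>m m"
    using append_cols_mult_transpose[OF WG2(1) WG1(1)] WG2(2)
    by (simp add: real_orthogonal_mat_def)
  from invariant_subspace_decomposition[OF G(1) WG2(1) WG1(1,3) this]
  show "G = WG2 * G11 * WG2\<^sup>T + WG1 * G21 * WG2\<^sup>T + WG1 * LG1 * WG1\<^sup>T"
    by (simp only: G11 G21)
next
  have carr: "R\<^sup>T \<in> carrier_mat m m" "TR2\<^sup>T \<in> carrier_mat m l" "TR1\<^sup>T \<in> carrier_mat m (m - l)"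
    "LR1\<^sup>T \<in> carrier_mat (m - l) (m - l)"
    using R(1) TR2(1) TR1(1,2) by auto
  \<comment> \<open>Stacked rows become adjacent columns under transposition, so for
    \<open>Q = TR2 @\<^sub>r TR1\<close> the relation that enters is
    \<open>Q\<^sup>T * Q = 1\<^sub>m m\<close>. The double transposes fit the decomposition with
    \<open>V = TR2\<^sup>T\<close> and \<open>W = TR1\<^sup>T\<close>.\<close>
  have res: "TR2\<^sup>T * TR2\<^sup>T\<^sup>T + TR1\<^sup>T * TR1\<^sup>T\<^sup>T = 1\<^sub>m m"
    using append_cols_mult_transpose[OF carr(2,3)] TR2(2)
    by (simp add: real_orthogonal_mat_def flip: append_rows_transpose[OF TR2(1) TR1(1)])
  \<comment> \<open>The rows of \<open>TR1\<close> span a left invariant subspace of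
    \<open>R\<close>, hence a right invariant one of \<open>R\<^sup>T\<close>.\<close>
  have inv: "R\<^sup>T * TR1\<^sup>T = TR1\<^sup>T * LR1\<^sup>T"
    using TR1(3) by (simp flip: transpose_mult[OF TR1(1) R(1)] transpose_mult[OF TR1(2,1)])
  \<comment> \<open>The three summands for \<open>R\<^sup>T\<close>, double transposes removed, are
    named so that each can be transposed back separately.\<close>
  define X where "X = TR2\<^sup>T * (TR2 * R\<^sup>T * TR2\<^sup>T) * TR2"
  define Y where "Y = TR1\<^sup>T * (TR1 * R\<^sup>T * TR2\<^sup>T) * TR2"
  define Z where "Z = TR1\<^sup>T * LR1\<^sup>T * TR1"
  have prods: "TR2 * R\<^sup>T * TR2\<^sup>T \<in> carrier_mat l l" "TR1 * R\<^sup>T * TR2\<^sup>T \<in> carrier_mat (m - l) l"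
    using TR2(1) TR1(1) carr by (meson mult_carrier_mat)+
  have XYZ: "X \<in> carrier_mat m m" "Y \<in> carrier_mat m m" "Z \<in> carrier_mat m m"
    unfolding X_def Y_def Z_def using prods TR2(1) TR1(1) carr by (meson mult_carrier_mat)+
  have "R\<^sup>T = X + Y + Z"
    using invariant_subspace_decomposition[OF carr(1-3) inv res]
    by (simp only: X_def Y_def Z_def transpose_transpose)
  then have "R = (X + Y + Z)\<^sup>T"
    by (metis transpose_transpose)
  also have "\<dots> = X\<^sup>T + Y\<^sup>T + Z\<^sup>T"
    using XYZ by (simp add: transpose_add[of _ m m])
  also have "X\<^sup>T = TR2\<^sup>T * R11 * TR2"
    by (simp only: X_def R11 transpose_mult3[OF carr(2) prods(1) TR2(1)]
        transpose_mult3[OF TR2(1) carr(1,2)] transpose_transpose)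
  \<comment> \<open>Transposing back swaps the outer factors, so the coupling block moves from
    position 21, as for \<open>G\<close>, to position 12.\<close>
  also have "Y\<^sup>T = TR2\<^sup>T * R12 * TR1"
    by (simp only: Y_def R12 transpose_mult3[OF carr(3) prods(2) TR2(1)]
        transpose_mult3[OF TR1(1) carr(1,2)] transpose_transpose)
  also have "Z\<^sup>T = TR1\<^sup>T * LR1 * TR1"
    by (simp only: Z_def transpose_mult3[OF carr(3,4) TR1(1)] transpose_transpose)
  finally show "R = TR2\<^sup>T * R11 * TR2 + TR2\<^sup>T * R12 * TR1 + TR1\<^sup>T * LR1 * TR1" .
qed

end
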